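(* Let $F$ be a Steiner equiangular tight frame consisting of $N$ vectors in $M$-dimensional space. Then $F$ does not have the $(K,\delta)$-restricted isometry property for any $\delta<1$ and any integer $K\ge 1+\left(\frac{M(N-1)}{N-M}\right)^{1/2}$.
   Context: A $(2,k,v)$-Steiner system, $2\le k\le v$, is a $v$-element set $V$ together with a collection $\mathcal{B}$ of $k$-element subsets of $V$ (blocks) such that every $2$-element subset of $V$ is contained in exactly one block. Every point then lies in exactly $r=\frac{v-1}{k-1}$ blocks and there are $b=\frac{v(v-1)}{k(k-1)}$ blocks. Its transposed incidence matrix $A^{\mathrm T}$ is the $b\times v$ $\{0,1\}$-matrix, rows indexed by blocks and columns by points, having a one exactly when the block contains the point. A Steiner equiangular tight frame is an $M\times N$ matrix $F$, with $M=b$ and $N=v(1+r)$, obtained from some $(2,k,v)$-Steiner system as follows. For each $j=1,\dots,v$, let $H_j$ be any $(1+r)\times(1+r)$ real or complex matrix with orthogonal rows and entries of modulus one. Let $F_j$ be the $b\times(1+r)$ matrix obtained from the $j$th column of $A^{\mathrm T}$ by replacing each one-valued entry with a distinct row of $H_j$ and each zero-valued entry with a row of zeros. Then $F=\left(\frac{k-1}{v-1}\right)^{1/2}[F_1\ \cdots\ F_v]$. The frame vectors are the columns of $F$. They form an equiangular tight frame: they have unit norm, their pairwise inner products have constant modulus, and $FF^*$ is a positive multiple of the identity. An $M\times N$ matrix $F$ has the $(K,\delta)$-restricted isometry property if $(1-\delta)\|g\|_2^2\le\|Fg\|_2^2\le(1+\delta)\|g\|_2^2$ for all $g\in\mathbb{C}^N$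 that are $K$-sparse, i.e. for which $g(n)\ne0$ for at most $K$ values of $n$. *)

theory Defs
  imports "Jordan_Normal_Form.Matrix" "Jordan_Normal_Form.Conjugate" "HOL-Analysis.L2_Norm"
begin

definition steiner_system :: "nat \<Rightarrow> nat \<Rightarrow> 'a set \<Rightarrow> 'a set set \<Rightarrow> bool" where
  "steiner_system k v V B \<longleftrightarrow>
     2 \<le> k \<and> k \<le> v \<and> finite V \<and> card V = v \<and>
     (\<forall>b\<in>B. b \<subseteq> V \<and> card b = k) \<and>
     (\<forall>S. S \<subseteq> V \<and> card S = 2 \<longrightarrow> (\<exists>!b. b \<in> B \<and> S \<subseteq> b))"

(* Row i stands for the block bl i and column j for the point pt j. *)
definition incidence_transposed ::
    "nat \<Rightarrow> nat \<Rightarrow> (nat \<Rightarrow> 'a set) \<Rightarrow> (nat \<Rightarrow> 'a) \<Rightarrow> complex mat" where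
  "incidence_transposed b v bl pt = mat b v (\<lambda>(i, j). if pt j \<in> bl i then 1 else 0)"

definition unimodular_orthogonal_rows :: "nat \<Rightarrow> complex mat \<Rightarrow> bool" where
  "unimodular_orthogonal_rows n H \<longleftrightarrow>
     H \<in> carrier_mat n n \<and>
     (\<forall>i<n. \<forall>l<n. cmod (H $$ (i, l)) = 1) \<and>
     (\<forall>i<n. \<forall>i'<n. i \<noteq> i' \<longrightarrow> row H i \<bullet>c row H i' = 0)"

(* The one-valued entry in row i of a {0,1}-vector a is replaced by row s i of H,
   the zero-valued entries by zero rows. *)
definition row_substitution :: "complex vec \<Rightarrow> complex mat \<Rightarrow> (nat \<Rightarrow> nat) \<Rightarrow> complex mat" where
  "row_substitution a H s =
     mat (dim_vec a) (dim_col H) (\<lambda>(i, l). if a $ i = 1 then H $$ (s i, l) else 0)"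

(* The horizontal concatenation of v matrices, each of size m x n. *)
definition concat_cols :: "nat \<Rightarrow> nat \<Rightarrow> nat \<Rightarrow> (nat \<Rightarrow> complex mat) \<Rightarrow> complex mat" where
  "concat_cols m n v G = mat m (v * n) (\<lambda>(i, c). G (c div n) $$ (i, c mod n))"

(* F is a Steiner equiangular tight frame built from the (2,k,v)-Steiner system (V, B).
   The division in r is exact for every Steiner system.  Points and blocks may be
   enumerated in any order.  Injectivity of s j expresses that the rows of H j used
   are distinct.  Real matrices H j are covered through the embedding into the complex
   numbers. *)
definition steiner_etf :: "nat \<Rightarrow> nat \<Rightarrow> 'a set \<Rightarrow> 'a set set \<Rightarrow> complex mat \<Rightarrow> bool" where
  "steiner_etf k v V B F \<longleftrightarrow>
     steiner_system k v V B \<and>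
     (let r = (v - 1) div (k - 1); b = card B in
      \<exists>bl pt H s.
        bij_betw bl {..<b} B \<and> bij_betw pt {..<v} V \<and>
        (let AT = incidence_transposed b v bl pt in
          (\<forall>j<v. unimodular_orthogonal_rows (1 + r) (H j) \<and>
                 s j ` {i. i < b \<and> AT $$ (i, j) = 1} \<subseteq> {..<1 + r} \<and>
                 inj_on (s j) {i. i < b \<and> AT $$ (i, j) = 1}) \<and>
          F = complex_of_real (sqrt ((real k - 1) / (real v - 1))) \<cdot>\<^sub>m
                concat_cols b (1 + r) v (\<lambda>j. row_substitution (col AT j) (H j) (s j))))"

definition l2_norm :: "complex vec \<Rightarrow> real" where
  "l2_norm g = L2_set (\<lambda>n. cmod (g $ n)) {..<dim_vec g}"

definition sparse :: "nat \<Rightarrow> complex vec \<Rightarrow> bool" where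
  "sparse K g \<longleftrightarrow> card {n. n < dim_vec g \<and> g $ n \<noteq> 0} \<le> K"

definition restricted_isometry :: "nat \<Rightarrow> real \<Rightarrow> complex mat \<Rightarrow> bool" where
  "restricted_isometry K \<delta> F \<longleftrightarrow>
     (\<forall>g \<in> carrier_vec (dim_col F). sparse K g \<longrightarrow>
        (1 - \<delta>) * (l2_norm g)\<^sup>2 \<le> (l2_norm (F *\<^sub>v g))\<^sup>2 \<and>
        (l2_norm (F *\<^sub>v g))\<^sup>2 \<le> (1 + \<delta>) * (l2_norm g)\<^sup>2)"

end

theory Submission
  imports Defs
begin

text \<open>
  A Steiner equiangular tight frame contains a dependent set of \<open>1 + r\<close> columns, where \<open>r\<close> is the
  number of blocks through a point. Fix a point \<open>j\<close>. Only \<open>r\<close> of the \<open>1 + r\<close> rows of \<open>H\<^sub>j\<close> are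
  placed into \<open>F\<^sub>j\<close>, so some row \<open>h\<close> of \<open>H\<^sub>j\<close> is left over, and it is orthogonal to every row that
  was placed. Hence the complex conjugate of \<open>h\<close>, supported on the columns of \<open>F\<^sub>j\<close>, is a nonzero
  \<open>(1 + r)\<close>-sparse vector in the kernel of \<open>F\<close> (lemma \<open>unused_row_in_kernel\<close>). A nonzero
  \<open>K\<close>-sparse kernel vector contradicts the lower bound of the restricted isometry property for
  every \<open>\<delta> < 1\<close> (lemma \<open>sparse_kernel_vector_not_restricted_isometry\<close>).

  It remains to see that the bound on \<open>K\<close> in the theorem is exactly \<open>1 + r\<close>. Double counting gives
  \<open>r (k - 1) = v - 1\<close> and \<open>M k = v r\<close>, and with \<open>N = v (1 + r)\<close> these identities turn
  \<open>M (N - 1) / (N - M)\<close> into \<open>r\<^sup>2\<close> (lemma \<open>steiner_welch_bound\<close>); in other words, the reciprocal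
  of the Welch bound on the coherence is \<open>r\<close>.
\<close>

section \<open>Parameters of Steiner systems\<close>

text \<open>The blocks through \<open>p\<close>, with \<open>p\<close> removed, partition the remaining points.\<close>

lemma steiner_blocks_through_point:
  assumes S: "steiner_system k v V B" and p: "p \<in> V"
  shows "card {b \<in> B. p \<in> b} * (k - 1) = v - 1"
proof -
  have V: "finite V" "card V = v"
    and blk: "\<And>b. b \<in> B \<Longrightarrow> b \<subseteq> V \<and> card b = k"
    and ex1: "\<And>S. S \<subseteq> V \<Longrightarrow> card S = 2 \<Longrightarrow> \<exists>!b. b \<in> B \<and> S \<subseteq> b"
    using S unfolding steiner_system_def by auto
  have pair: "\<exists>!b. b \<in> B \<and> {p, q} \<subseteq> b" if "q \<in> V" "q \<noteq> p" for q
    using ex1[of "{p, q}"] that p by auto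
  let ?P = "{b \<in> B. p \<in> b}"
  have "finite B"
    using blk V(1) by (meson Pow_iff finite_Pow_iff finite_subset subsetI)
  then have finP: "finite ?P" by simp
  have fin: "finite b" if "b \<in> B" for b
    using blk[OF that] V(1) finite_subset by blast
  have disj: "(b - {p}) \<inter> (b' - {p}) = {}" if "b \<in> ?P" "b' \<in> ?P" "b \<noteq> b'" for b b'
  proof (rule ccontr)
    assume "(b - {p}) \<inter> (b' - {p}) \<noteq> {}"
    then obtain q where "q \<in> b" "q \<in> b'" "q \<noteq> p" by auto
    with that pair[of q] blk[of b] show False by auto
  qed
  have cover: "(\<Union>b\<in>?P. b - {p}) = V - {p}"
  proof
    show "(\<Union>b\<in>?P. b - {p}) \<subseteq> V - {p}" using blk by blast
    show "V - {p} \<subseteq> (\<Union>b\<in>?P. b - {p})"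
    proof
      fix q assume q: "q \<in> V - {p}"
      then obtain b where "b \<in> B" "{p, q} \<subseteq> b" using pair[of q] by blast
      with q show "q \<in> (\<Union>b\<in>?P. b - {p})" by auto
    qed
  qed
  have "v - 1 = card (\<Union>b\<in>?P. b - {p})"
    using V p cover by simp
  also have "\<dots> = (\<Sum>b\<in>?P. card (b - {p}))"
    using finP fin disj by (intro card_UN_disjoint) auto
  also have "\<dots> = (\<Sum>b\<in>?P. k - 1)"
    using blk by (intro sum.cong) auto
  finally show ?thesis by simp
qed

lemma steiner_replication:
  assumes S: "steiner_system k v V B" and p: "p \<in> V"
  shows "card {b \<in> B. p \<in> b} = (v - 1) div (k - 1)"
proof -
  have "k - 1 \<noteq> 0" using S unfolding steiner_system_def by auto
  then show ?thesis
    using steiner_blocks_through_point[OF S p] by (metis nonzero_mult_div_cancel_right)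
qed

lemma steiner_block_count:
  assumes S: "steiner_system k v V B"
  shows "card B * k = v * ((v - 1) div (k - 1))"
proof -
  have V: "finite V" "card V = v"
    and blk: "\<And>b. b \<in> B \<Longrightarrow> b \<subseteq> V \<and> card b = k"
    using S unfolding steiner_system_def by auto
  have finB: "finite B"
    using blk V(1) by (meson Pow_iff finite_Pow_iff finite_subset subsetI)
  have "(\<Sum>b\<in>B. card {p \<in> V. p \<in> b}) = ((v - 1) div (k - 1)) * card V"
    using finB V steiner_replication[OF S] by (intro sum_multicount) auto
  moreover have "(\<Sum>b\<in>B. card {p \<in> V. p \<in> b}) = (\<Sum>b\<in>B. k)"
  proof (rule sum.cong)
    fix b assume "b \<in> B"
    with blk[of b] have "{p \<in> V. p \<in> b} = b" "card b = k" by auto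
    then show "card {p \<in> V. p \<in> b} = k" by simp
  qed simp
  ultimately show ?thesis using V by (simp add: mult.commute)
qed

lemma steiner_welch_bound:
  assumes S: "steiner_system k v V B"
    and r: "r = (v - 1) div (k - 1)" and M: "M = card B" and N: "N = v * (1 + r)"
  shows "real M * (real N - 1) / (real N - real M) = (real r)\<^sup>2"
proof -
  have kv: "2 \<le> k" "k \<le> v" and "card V = v"
    using S unfolding steiner_system_def by auto
  then obtain p where "p \<in> V" by (metis all_not_in_conv card.empty le_zero_eq not_numeral_le_zero)
  then have "r * (k - 1) = v - 1"
    using steiner_blocks_through_point[OF S] steiner_replication[OF S] r by metis
  then have "real r * real (k - 1) = real (v - 1)" by (metis of_nat_mult)
  then have vr: "real v = 1 + real r * (real k - 1)"
    using kv by (simp add: of_nat_diff)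
  have "real (M * k) = real (v * r)"
    using steiner_block_count[OF S] r M by presburger
  then have Mk: "real M * real k = real v * real r" by simp
  \<comment> \<open>The common factor of \<open>N - 1 = r D\<close> and \<open>k (N - M) = v D\<close>; it cancels in the quotient.\<close>
  define D where "D = real k + real k * real r - real r"
  have "real r \<le> real k * real r" using kv by (simp add: mult_le_cancel_right1)
  then have "D > 0" using kv unfolding D_def by linarith
  have kNM: "real k * (real N - real M) = real v * D"
    using Mk unfolding N D_def by (simp add: algebra_simps)
  have N1: "real N - 1 = real r * D"
    unfolding N D_def by (simp add: vr algebra_simps)
  have "real k * (real M * (real N - 1)) = (real M * real k) * (real r * D)"
    unfolding N1 by simp
  also have "\<dots> = (real r)\<^sup>2 * (real v * D)"
    unfolding Mk by (simp add: power2_eq_square)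
  also have "\<dots> = real k * ((real r)\<^sup>2 * (real N - real M))"
    unfolding kNM[symmetric] by simp
  finally have eq: "real M * (real N - 1) = (real r)\<^sup>2 * (real N - real M)"
    using kv by simp
  have "real k * (real N - real M) > 0"
    using kNM \<open>D > 0\<close> kv by simp
  then have "real N - real M \<noteq> 0" by auto
  then show ?thesis using eq by (simp add: field_simps)
qed

section \<open>Sparse kernel vectors\<close>

lemma sparse_kernel_vector_not_restricted_isometry:
  assumes g: "g \<in> carrier_vec (dim_col F)" "sparse K g"
    and nz: "i < dim_vec g" "g $ i \<noteq> 0"
    and ker: "F *\<^sub>v g = 0\<^sub>v (dim_row F)" and \<delta>: "\<delta> < 1"
  shows "\<not> restricted_isometry K \<delta> F"
proof
  assume "restricted_isometry K \<delta> F"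
  then have "(1 - \<delta>) * (l2_norm g)\<^sup>2 \<le> (l2_norm (F *\<^sub>v g))\<^sup>2"
    using g unfolding restricted_isometry_def by blast
  moreover have "l2_norm (F *\<^sub>v g) = 0"
    unfolding ker l2_norm_def by (simp add: L2_set_eq_0_iff)
  moreover have "l2_norm g \<noteq> 0"
    using nz unfolding l2_norm_def by (auto simp: L2_set_eq_0_iff)
  then have "(1 - \<delta>) * (l2_norm g)\<^sup>2 > 0"
    using \<delta> by simp
  ultimately show False by simp
qed

definition group_vec :: "nat \<Rightarrow> nat \<Rightarrow> nat \<Rightarrow> complex vec \<Rightarrow> complex vec" where
  "group_vec n v j h = vec (v * n) (\<lambda>c. if c div n = j then h $ (c mod n) else 0)"

lemma group_index_less:
  fixes n v j l :: nat
  assumes "j < v" "l < n"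
  shows "j * n + l < v * n"
proof -
  have "j * n + l < Suc j * n" using assms by simp
  also have "\<dots> \<le> v * n" using assms by (intro mult_le_mono1) simp
  finally show ?thesis .
qed

lemma concat_cols_mult_group_vec:
  assumes j: "j < v" and G: "G j \<in> carrier_mat m n" and h: "h \<in> carrier_vec n"
  shows "concat_cols m n v G *\<^sub>v group_vec n v j h = G j *\<^sub>v h"
proof (rule eq_vecI)
  fix i assume "i < dim_vec (G j *\<^sub>v h)"
  then have i: "i < m" using G by simp
  let ?g = "\<lambda>c. G (c div n) $$ (i, c mod n) * (if c div n = j then h $ (c mod n) else 0)"
  have "(concat_cols m n v G *\<^sub>v group_vec n v j h) $ i = (\<Sum>c = 0..<v * n. ?g c)"
    using i by (simp add: concat_cols_def group_vec_def scalar_prod_def)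
  also have "\<dots> = (\<Sum>c\<in>{c \<in> {0..<v * n}. c div n = j}. ?g c)"
    by (rule sum.mono_neutral_right) auto
  also have "\<dots> = (\<Sum>l = 0..<n. G j $$ (i, l) * h $ l)"
  proof (rule sum.reindex_bij_witness[where i = "\<lambda>l. j * n + l" and j = "\<lambda>c. c mod n"])
    fix c assume c: "c \<in> {c \<in> {0..<v * n}. c div n = j}"
    then show "j * n + c mod n = c" by auto
    from c have "0 < n" by (cases n) auto
    then show "c mod n \<in> {0..<n}" by simp
    from c show "G j $$ (i, c mod n) * h $ (c mod n) = ?g c" by auto
  next
    fix l assume "l \<in> {0..<n}"
    then show "j * n + l \<in> {c \<in> {0..<v * n}. c div n = j}"
      using group_index_less[OF j, of l n] by simp
  qed auto
  also have "\<dots> = (G j *\<^sub>v h) $ i"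
    using i G h by (simp add: scalar_prod_def)
  finally show "(concat_cols m n v G *\<^sub>v group_vec n v j h) $ i = (G j *\<^sub>v h) $ i" .
qed (use G in \<open>simp add: concat_cols_def\<close>)

lemma sparse_group_vec:
  assumes "n \<le> K"
  shows "sparse K (group_vec n v j h)"
proof -
  let ?S = "{c. c < dim_vec (group_vec n v j h) \<and> group_vec n v j h $ c \<noteq> 0}"
  have "?S \<subseteq> (\<lambda>l. j * n + l) ` {..<n}"
  proof
    fix c assume "c \<in> ?S"
    then have c: "c < v * n" "c div n = j"
      by (auto simp: group_vec_def split: if_splits)
    then have "0 < n" by (cases n) auto
    then have "c mod n \<in> {..<n}" by simp
    moreover have "j * n + c mod n = c" using c(2) by auto
    ultimately show "c \<in> (\<lambda>l. j * n + l) ` {..<n}" by (metis image_eqI)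
  qed
  then have "card ?S \<le> card {..<n}"
    by (rule surj_card_le[rotated]) simp
  then show ?thesis
    using assms unfolding sparse_def by simp
qed

text \<open>Each entry of the product is zero because row \<open>i\<close> of the substituted matrix is either zero or
  the row \<open>s i\<close> of \<open>H\<close>, which differs from row \<open>t\<close> and hence is orthogonal to it.\<close>

lemma unused_row_in_kernel:
  assumes H: "unimodular_orthogonal_rows n H"
    and s: "s ` {i. i < dim_vec a \<and> a $ i = 1} \<subseteq> {..<n}"
    and t: "t < n" "t \<notin> s ` {i. i < dim_vec a \<and> a $ i = 1}"
  shows "row_substitution a H s *\<^sub>v conjugate (row H t) = 0\<^sub>v (dim_vec a)"
proof (rule eq_vecI)
  have HC: "H \<in> carrier_mat n n"
    and orth: "\<And>i i'. i < n \<Longrightarrow> i' < n \<Longrightarrow> i \<noteq> i' \<Longrightarrow> row H i \<bullet>c row H i' = 0"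
    using H unfolding unimodular_orthogonal_rows_def by auto
  fix i assume "i < dim_vec (0\<^sub>v (dim_vec a) :: complex vec)"
  then have i: "i < dim_vec a" by simp
  show "(row_substitution a H s *\<^sub>v conjugate (row H t)) $ i = 0\<^sub>v (dim_vec a) $ i"
  proof (cases "a $ i = 1")
    case True
    then have si: "s i < n" "s i \<noteq> t" using s t i by auto
    have "row (row_substitution a H s) i = row H (s i)"
      using i True HC si by (intro eq_vecI) (auto simp: row_substitution_def)
    then show ?thesis using i orth[OF si(1) t(1) si(2)] by (simp add: row_substitution_def)
  next
    case False
    then have "row (row_substitution a H s) i = 0\<^sub>v n"
      using i HC by (intro eq_vecI) (auto simp: row_substitution_def)
    moreover have "conjugate (row H t) \<in> carrier_vec n" using HC by auto
    ultimately show ?thesis using i by (simp add: row_substitution_def)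
  qed
qed (simp add: row_substitution_def)

section \<open>Failure of the restricted isometry property\<close>

theorem mainTheorem4:
  fixes F :: "complex mat" and V :: "'a set" and B :: "'a set set"
    and k v M N K :: nat and \<delta> :: real
  assumes "steiner_etf k v V B F"
    and "F \<in> carrier_mat M N"
    and "\<delta> < 1"
    and "real K \<ge> 1 + sqrt (real M * (real N - 1) / (real N - real M))"
  shows "\<not> restricted_isometry K \<delta> F"
proof -
  define r where "r = (v - 1) div (k - 1)"
  define b where "b = card B"
  have S: "steiner_system k v V B"
    using assms(1) unfolding steiner_etf_def by blast
  obtain bl pt H s where bl: "bij_betw bl {..<b} B" and pt: "bij_betw pt {..<v} V"
    and Hs: "\<And>j. j < v \<Longrightarrow> unimodular_orthogonal_rows (1 + r) (H j) \<and>
         s j ` {i. i < b \<and> incidence_transposed b v bl pt $$ (i, j) = 1} \<subseteq> {..<1 + r}"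
    and F: "F = complex_of_real (sqrt ((real k - 1) / (real v - 1))) \<cdot>\<^sub>m
         concat_cols b (1 + r) v
           (\<lambda>j. row_substitution (col (incidence_transposed b v bl pt) j) (H j) (s j))"
    using assms(1) unfolding steiner_etf_def Let_def r_def[symmetric] b_def[symmetric] by blast
  define AT where "AT = incidence_transposed b v bl pt"
  define C where "C = concat_cols b (1 + r) v (\<lambda>j. row_substitution (col AT j) (H j) (s j))"
  have FC: "F = complex_of_real (sqrt ((real k - 1) / (real v - 1))) \<cdot>\<^sub>m C"
    using F unfolding C_def AT_def .
  have "dim_row C = b" "dim_col C = v * (1 + r)"
    unfolding C_def concat_cols_def by auto
  then have dims: "dim_row F = b" "dim_col F = v * (1 + r)" "C \<in> carrier_mat b (v * (1 + r))"
    using FC by auto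
  then have "M = b" "N = v * (1 + r)" using assms(2) by auto
  then have "real M * (real N - 1) / (real N - real M) = (real r)\<^sup>2"
    using steiner_welch_bound[OF S r_def b_def] by simp
  then have K: "1 + r \<le> K" using assms(4) by simp
  have v0: "0 < v" using S unfolding steiner_system_def by auto
  \<comment> \<open>Every point would do; the first one is chosen.\<close>
  define a where "a = col AT 0"
  have a: "dim_vec a = b" "\<And>i. i < b \<Longrightarrow> a $ i = 1 \<longleftrightarrow> pt 0 \<in> bl i"
    using v0 unfolding a_def AT_def incidence_transposed_def by auto
  define I where "I = {i. i < dim_vec a \<and> a $ i = 1}"
  have "pt 0 \<in> V" using pt v0 by (auto dest: bij_betwE)
  then have "card {c \<in> B. pt 0 \<in> c} = r"
    using steiner_replication[OF S] r_def by simp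
  moreover have "bij_betw bl I {c \<in> B. pt 0 \<in> c}"
    unfolding I_def using bl a by (auto simp: bij_betw_def inj_on_def)
  ultimately have "card I = r" using bij_betw_same_card by fastforce
  moreover have "finite I" unfolding I_def by simp
  ultimately have "card (s 0 ` I) < card {..<1 + r}"
    using card_image_le[of I "s 0"] by simp
  then obtain t where t: "t < 1 + r" "t \<notin> s 0 ` I"
    using \<open>finite I\<close> by (metis card_mono finite_imageI lessThan_iff not_le subsetI)
  have H0: "unimodular_orthogonal_rows (1 + r) (H 0)"
    using Hs[OF v0] by blast
  then have H0C: "H 0 \<in> carrier_mat (1 + r) (1 + r)" and unim: "cmod (H 0 $$ (t, 0)) = 1"
    using t(1) unfolding unimodular_orthogonal_rows_def by auto
  have "I = {i. i < b \<and> AT $$ (i, 0) = 1}"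
    using v0 unfolding I_def a_def AT_def incidence_transposed_def by auto
  then have sI: "s 0 ` I \<subseteq> {..<1 + r}"
    using Hs[OF v0] unfolding AT_def by simp
  define h where "h = conjugate (row (H 0) t)"
  have h: "h \<in> carrier_vec (1 + r)" unfolding h_def using H0C by (intro carrier_vecI) simp
  define g where "g = group_vec (1 + r) v 0 h"
  have g: "g \<in> carrier_vec (v * (1 + r))" unfolding g_def group_vec_def by simp
  have "row_substitution a (H 0) (s 0) \<in> carrier_mat b (1 + r)"
    using a(1) H0C unfolding row_substitution_def by auto
  then have "C *\<^sub>v g = row_substitution a (H 0) (s 0) *\<^sub>v h"
    unfolding C_def g_def a_def using concat_cols_mult_group_vec[OF v0 _ h] by fastforce
  also have "\<dots> = 0\<^sub>v b"
    using unused_row_in_kernel[OF H0, of "s 0" a t] sI t a(1) unfolding h_def I_def by simp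
  finally have "C *\<^sub>v g = 0\<^sub>v b" .
  then have "row C i \<bullet> g = 0" if "i < b" for i
    using that dims(3) by (metis carrier_matD(1) index_mult_mat_vec index_zero_vec(1))
  then have ker: "F *\<^sub>v g = 0\<^sub>v (dim_row F)"
    unfolding FC using dims(3) g
    by (intro eq_vecI) (auto simp: smult_scalar_prod_distrib[of _ "v * (1 + r)"])
  have "g $ 0 = cnj (H 0 $$ (t, 0))"
    using v0 H0C t(1) unfolding g_def group_vec_def h_def by simp
  then have "g $ 0 \<noteq> 0" using unim by auto
  moreover have "0 < dim_vec g" using g v0 by simp
  moreover have "sparse K g" unfolding g_def using K by (rule sparse_group_vec)
  ultimately show ?thesis
    using sparse_kernel_vector_not_restricted_isometry g dims(2) ker assms(3) by metis
qed

end
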